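(* Let $2 \le m \le n$ and $1 \le k \le m$. Let $P$ be a nonzero orthogonal projection on $\mathcal{H}_n \otimes \mathcal{H}_m$ (so $P = P^* = P^2$). Then \[ \|P\|_{S(k)} \ge \min\Big\{1, \frac{k}{\big\lceil \tfrac12\big(n+m-\sqrt{(n-m)^2 + 4\,\mathrm{rank}(P) - 4}\big)\big\rceil}\Big\} \] and \[ \|P\|_{S(k)} \ge \frac{(k-1)mn + (m-k)\,\mathrm{rank}(P)}{mn(m-1)}. \]
   Context: $\mathcal{H}_d = \mathbb{C}^d$ and $m\le n$. $SR$ denotes Schmidt rank, i.e. the number of nonzero singular values of the coefficient matrix of a vector in $\mathcal{H}_n\otimes\mathcal{H}_m$. For $1\le k\le m$, \[ \|X\|_{S(k)} := \sup\{|\langle w|X|v\rangle| : |v\rangle,|w\rangle \text{ unit vectors}, SR(|v\rangle),SR(|w\rangle)\le k\}. \] *)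

theory Defs
  imports "HOL-Analysis.Analysis"
begin

text \<open>Vectors of H_n (x) H_m are modelled as complex^('n \<times> 'm), with n = CARD('n),
  m = CARD('m); the basis vector e_i (x) e_j corresponds to index (i,j).
  Operators on H_n (x) H_m are matrices complex^('n \<times> 'm)^('n \<times> 'm).\<close>

definition coeff_mat :: "complex^('n::finite \<times> 'm::finite) \<Rightarrow> complex^'m^'n" where
  "coeff_mat v = (\<chi> i j. v $ (i, j))"

definition schmidt_rank :: "complex^('n::finite \<times> 'm::finite) \<Rightarrow> nat" where
  "schmidt_rank v = rank (coeff_mat v)"

definition adjoint_mat :: "complex^'a^'a \<Rightarrow> complex^'a^'a" where
  "adjoint_mat X = (\<chi> i j. cnj (X $ j $ i))"

definition bra_ket :: "complex^'a::finite \<Rightarrow> complex^'a^'a \<Rightarrow> complex^'a \<Rightarrow> complex" where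
  "bra_ket w X v = (\<Sum>i\<in>UNIV. cnj (w $ i) * (X *v v) $ i)"

definition SK_norm :: "nat \<Rightarrow> complex^('n::finite \<times> 'm::finite)^('n \<times> 'm) \<Rightarrow> real" where
  "SK_norm k X = Sup {cmod (bra_ket w X v) | v w.
      norm v = 1 \<and> norm w = 1 \<and> schmidt_rank v \<le> k \<and> schmidt_rank w \<le> k}"

end

theory Submission
  imports Defs
begin

text \<open>Keeping the \<open>k\<close> heaviest of the mutually orthogonal rank-one pieces of a unit vector \<open>x\<close> in the range
  of \<open>P\<close> gives a vector \<open>w\<close> of Schmidt rank at most \<open>k\<close> with \<open>\<langle>x, w\<rangle> = norm(w)\<^sup>2\<close>, and normalising
  \<open>w\<close> shows that the \<open>S(k)\<close>-norm of \<open>P\<close> is at least \<open>norm(w)\<^sup>2\<close>.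

  For the first bound, \<open>x\<close> has Schmidt rank at most \<open>r\<close>, the ceiling in the bound: since
  \<open>(n - r) (m - r) < rank P\<close>, the range of \<open>P\<close> meets the matrices of rank at most \<open>r\<close>. This dimension count is obtained
  without algebraic geometry, from a minimal-distance argument on the cone of matrices of rank at
  most \<open>r\<close>. For the second bound, \<open>x\<close> is the normalised projection of a standard basis vector
  \<open>e\<^sub>i \<otimes> e\<^sub>j\<close> on which the diagonal of \<open>P\<close> is at least average, and the pieces are the columns of
  \<open>x\<close>, column \<open>j\<close> always being kept.\<close>

section \<open>Rank of matrices over a field\<close>

lemma matrix_add_rdistrib_gen: "((B :: 'a::semiring_1^'n^'m) + C) ** A = B ** A + C ** A"
  by (vector matrix_matrix_mult_def sum.distrib[symmetric] field_simps)

lemma matrix_diff_rdistrib: "((B :: 'a::ring_1^'n^'m) - C) ** A = B ** A - C ** A"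
  by (vector matrix_matrix_mult_def sum_subtractf[symmetric] left_diff_distrib)

lemma matrix_diff_ldistrib: "(A :: 'a::ring_1^'n^'m) ** (B - C) = A ** B - A ** C"
  by (vector matrix_matrix_mult_def sum_subtractf[symmetric] right_diff_distrib)

lemmas matrix_distribs = matrix_add_rdistrib_gen matrix_add_ldistrib matrix_diff_rdistrib matrix_diff_ldistrib

text \<open>Every row of \<open>A\<close> lies in the span of the vectors \<open>w l\<close>. With
  \<open>rank_factorization\<close> as the converse, rank is the least number of rank-one summands,
  and the rank inequalities below come from manipulating such decompositions.\<close>

lemma rank_sum_outer_le:
  fixes A :: "'a::field^'m^'n"
  assumes "finite I" and A: "\<And>i j. A $ i $ j = (\<Sum>l\<in>I. u l i * w l $ j)"
  shows "rank A \<le> card I"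
proof -
  have "rows A \<subseteq> vec.span (w ` I)"
  proof
    fix x assume "x \<in> rows A"
    then obtain i where "x = row i A" by (auto simp: rows_def)
    then have "x = (\<Sum>l\<in>I. u l i *s w l)"
      by (simp add: vec_eq_iff row_def A sum_component)
    then show "x \<in> vec.span (w ` I)"
      by (simp add: vec.span_base vec.span_scale vec.span_sum)
  qed
  then have "rank A \<le> card (w ` I)"
    unfolding row_rank_def_gen by (rule vec.dim_le_card) (simp add: assms)
  also have "\<dots> \<le> card I" by (rule card_image_le) fact
  finally show ?thesis .
qed

lemma rank_factorization:
  fixes A :: "'a::field^'m^'n"
  obtains B :: "('a^'m) set" and u where "finite B" "card B = rank A"
    "\<And>i j. A $ i $ j = (\<Sum>b\<in>B. u b i * b $ j)"
proof -
  obtain B where B: "B \<subseteq> rows A" "vec.independent B" "rows A \<subseteq> vec.span B" "card B = vec.dim (rows A)"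
    using vec.basis_exists by blast
  have fin: "finite B" using B(2) by (rule vec.finiteI_independent)
  have "\<exists>c. row i A = (\<Sum>b\<in>B. c b *s b)" for i
  proof -
    have "row i A \<in> vec.span B" using B(3) by (auto simp: rows_def)
    then show ?thesis unfolding vec.span_finite[OF fin] by auto
  qed
  then obtain c where c: "\<And>i. row i A = (\<Sum>b\<in>B. c i b *s b)" by metis
  have "A $ i $ j = (\<Sum>b\<in>B. c i b * b $ j)" for i j
    using arg_cong[OF c[of i], of "\<lambda>x. x $ j"] by (simp add: row_def sum_component)
  then show ?thesis using that[of B "\<lambda>b i. c i b"] fin B(4) by (simp add: row_rank_def_gen)
qed

lemma rank_transpose_gen:
  fixes A :: "'a::field^'m^'n"
  shows "rank (transpose A) = rank A"
proof -
  have le: "rank (transpose A) \<le> rank A" for A :: "'a^'i^'j"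
  proof -
    obtain B u where B: "finite B" "card B = rank A"
      and A: "\<And>i j. A $ i $ j = (\<Sum>b\<in>B. u b i * b $ j)"
      by (rule rank_factorization[of A]) blast
    have "rank (transpose A) \<le> card B"
      by (rule rank_sum_outer_le[where u = "\<lambda>b j. b $ j" and w = "\<lambda>b. \<chi> i. u b i"])
        (auto simp: transpose_def A B mult.commute)
    then show ?thesis using B by simp
  qed
  from le[of A] le[of "transpose A"] show ?thesis by simp
qed

lemma rank_add_le:
  fixes A B :: "'a::field^'m^'n"
  shows "rank (A + B) \<le> rank A + rank B"
proof -
  obtain S u where S: "finite S" "card S = rank A" and A: "\<And>i j. A $ i $ j = (\<Sum>b\<in>S. u b i * b $ j)"
    by (rule rank_factorization[of A]) blast
  obtain T v where T: "finite T" "card T = rank B" and B: "\<And>i j. B $ i $ j = (\<Sum>b\<in>T. v b i * b $ j)"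
    by (rule rank_factorization[of B]) blast
  \<comment> \<open>The disjoint sum keeps the two families of summands apart even when
    \<open>S\<close> and \<open>T\<close> share vectors.\<close>
  have "rank (A + B) \<le> card (S <+> T)"
    by (rule rank_sum_outer_le[where u = "case_sum u v" and w = "case_sum id id"])
      (simp_all add: A B S T sum.Plus comp_def)
  then show ?thesis using S T by (simp add: card_Plus)
qed

lemma rank_mul_le_left_gen:
  fixes A :: "'a::field^'m^'n" and B :: "'a^'k^'m"
  shows "rank (A ** B) \<le> rank A"
proof -
  obtain S u where S: "finite S" "card S = rank A" and A: "\<And>i j. A $ i $ j = (\<Sum>b\<in>S. u b i * b $ j)"
    by (rule rank_factorization[of A]) blast
  have "rank (A ** B) \<le> card S"
  proof (rule rank_sum_outer_le[where u = u and w = "\<lambda>b. b v* B"])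
    fix i j
    have "(A ** B) $ i $ j = (\<Sum>k\<in>UNIV. \<Sum>b\<in>S. u b i * (b $ k * B $ k $ j))"
      by (simp add: matrix_matrix_mult_def A sum_distrib_right mult.assoc)
    also have "\<dots> = (\<Sum>b\<in>S. u b i * (b v* B) $ j)"
      by (subst sum.swap) (simp add: vector_matrix_mult_def sum_distrib_left)
    finally show "(A ** B) $ i $ j = (\<Sum>b\<in>S. u b i * (b v* B) $ j)" .
  qed (fact S)
  then show ?thesis using S by simp
qed

lemma rank_mul_le_right_gen:
  fixes A :: "'a::field^'m^'n" and B :: "'a^'k^'m"
  shows "rank (A ** B) \<le> rank B"
  using rank_mul_le_left_gen[of "transpose B" "transpose A"]
  by (simp add: rank_transpose_gen flip: matrix_transpose_mul)

lemma rank_dim_range_gen: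
  fixes A :: "'a::field^'m^'n"
  shows "rank A = vec.dim (range ((*v) A))"
proof -
  have "columns A \<subseteq> range ((*v) A)"
  proof
    fix x assume "x \<in> columns A"
    then obtain j where "x = column j A" by (auto simp: columns_def)
    also have "\<dots> = A *v axis j 1"
      by (simp add: vec_eq_iff column_def matrix_vector_mult_def axis_def if_distrib cong: if_cong)
    finally show "x \<in> range ((*v) A)" by blast
  qed
  then have "vec.dim (columns A) \<le> vec.dim (range ((*v) A))" by (rule vec.dim_subset)
  moreover have "vec.dim (range ((*v) A)) \<le> vec.dim (columns A)"
    by (rule vec.dim_mono) (auto intro: matrix_vector_mult_in_columnspace_gen)
  moreover have "rank A = vec.dim (columns A)"
    using rank_transpose_gen[of A] by (simp add: row_rank_def_gen)
  ultimately show ?thesis by simp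
qed

lemma rank_mat_1: "rank (mat 1 :: 'a::field^'n^'n) = CARD('n)"
  by (simp add: rank_dim_range_gen card_cart_basis)

lemma rank_eq_0_gen: "rank (A :: 'a::field^'m^'n) = 0 \<longleftrightarrow> A = 0"
proof
  assume "rank A = 0"
  then have "range ((*v) A) \<subseteq> {0}" by (simp add: rank_dim_range_gen)
  then show "A = 0" by (auto simp: matrix_eq)
next
  assume "A = 0"
  then show "rank A = 0" by (auto simp: rank_dim_range_gen)
qed

text \<open>The two ranges meet only in 0, because \<open>e\<close> fixes its own range and kills
  that of \<open>f\<close>; and \<open>e + f\<close> fixes every vector of their sum.\<close>

lemma rank_orthogonal_idempotents_le:
  fixes e f :: "'a::field^'n^'n"
  assumes e: "e ** e = e" "e ** f = 0" and f: "f ** f = f" "f ** e = 0"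
  shows "rank e + rank f \<le> rank (e + f)"
proof -
  let ?E = "range ((*v) e)" and ?F = "range ((*v) f)"
  have sub: "vec.subspace (range ((*v) A))" for A :: "'a^'n^'n"
    by (rule vec.subspace_image) simp
  have ex: "e *v (e *v x) = e *v x" "e *v (f *v x) = 0"
    "f *v (f *v x) = f *v x" "f *v (e *v x) = 0" for x
    using e f by (simp_all add: matrix_vector_mul_assoc)
  have "?E \<inter> ?F \<subseteq> {0}"
  proof
    fix x assume "x \<in> ?E \<inter> ?F"
    then obtain a b where "x = e *v a" "x = f *v b" by blast
    then have "x = e *v x" "e *v x = 0" using ex(1)[of a] ex(2)[of b] by simp_all
    then show "x \<in> {0}" by simp
  qed
  then have "vec.dim (?E \<inter> ?F) = 0" by simp
  moreover have "{x + y |x y. x \<in> ?E \<and> y \<in> ?F} \<subseteq> range ((*v) (e + f))"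
  proof clarify
    fix a b
    have "e *v a + f *v b = (e + f) *v (e *v a + f *v b)"
      by (simp add: algebra_simps ex)
    then show "e *v a + f *v b \<in> range ((*v) (e + f))" by blast
  qed
  then have "vec.dim {x + y |x y. x \<in> ?E \<and> y \<in> ?F} \<le> rank (e + f)"
    unfolding rank_dim_range_gen by (rule vec.dim_subset)
  ultimately show ?thesis
    using vec.dim_sums_Int[OF sub[of e] sub[of f]] unfolding rank_dim_range_gen by linarith
qed

text \<open>The invertible matrix has full rank, while \<open>mat 1 - e\<close> contributes at most
  the complement of \<open>rank e\<close>; \<open>B\<close> must supply the rest.\<close>

lemma rank_ge_if_idempotent_perturbation:
  fixes e B :: "'a::field^'n^'n"
  assumes e: "e ** e = e" and inv: "invertible (mat 1 - e + B)"
  shows "rank e \<le> rank B"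
proof -
  obtain D where "(mat 1 - e + B) ** D = mat 1"
    using inv by (auto simp: invertible_def)
  then have "CARD('n) \<le> rank (mat 1 - e + B)"
    using rank_mul_le_left_gen[of "mat 1 - e + B" D] by (simp add: rank_mat_1)
  also have "\<dots> \<le> rank (mat 1 - e) + rank B" by (rule rank_add_le)
  finally have 1: "CARD('n) \<le> rank (mat 1 - e) + rank B" .
  have "rank e + rank (mat 1 - e) \<le> rank (e + (mat 1 - e))"
    by (rule rank_orthogonal_idempotents_le) (simp_all add: matrix_distribs e)
  with 1 show ?thesis by (simp add: rank_mat_1)
qed

text \<open>\<open>Y\<close> represents a linear right inverse of \<open>A\<close> on its range. It
  makes \<open>A ** Y\<close> an idempotent onto the column space of \<open>A\<close> and
  \<open>Y ** A\<close> an idempotent with the same kernel as \<open>A\<close>.\<close>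

lemma generalized_inverse_exists:
  fixes A :: "'a::field^'m^'n"
  obtains Y where "A ** Y ** A = A"
proof -
  obtain g where g: "Vector_Spaces.linear (*s) (*s) g" "\<And>v. v \<in> range ((*v) A) \<Longrightarrow> A *v g v = v"
    using vec.linear_exists_right_inverse_on[of "(*v) A" UNIV] by auto
  have "A ** matrix g ** A = A"
    by (simp add: matrix_eq flip: matrix_vector_mul_assoc)
      (simp add: matrix_works[OF g(1)] g(2))
  then show ?thesis by (rule that)
qed

section \<open>Continuity and lower semicontinuity of the rank\<close>

lemma continuous_on_det:
  fixes f :: "'b::topological_space \<Rightarrow> 'a::{real_normed_field}^'n^'n"
  assumes "continuous_on S f"
  shows "continuous_on S (\<lambda>x. det (f x))"
  unfolding det_def using assms by (intro continuous_intros)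

lemma continuous_on_matrix_mult_left:
  fixes f :: "'b::topological_space \<Rightarrow> complex^'m^'n" and A :: "complex^'n^'k"
  assumes "continuous_on S f"
  shows "continuous_on S (\<lambda>x. A ** f x)"
  unfolding matrix_matrix_mult_def using assms by (intro continuous_intros)

lemma continuous_on_matrix_mult_right:
  fixes f :: "'b::topological_space \<Rightarrow> complex^'m^'n" and A :: "complex^'k^'m"
  assumes "continuous_on S f"
  shows "continuous_on S (\<lambda>x. f x ** A)"
  unfolding matrix_matrix_mult_def using assms by (intro continuous_intros)

text \<open>If \<open>A Y A = A\<close>, then \<open>1 - Y A + Y B\<close> is invertible for \<open>B\<close> near \<open>A\<close>, which forces
  \<open>rank B \<ge> rank A\<close>.\<close>

lemma closed_rank_le: "closed {A :: complex^'m^'n. rank A \<le> r}"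
proof -
  have "open {A :: complex^'m^'n. r < rank A}"
  proof (subst open_subopen, safe)
    fix A :: "complex^'m^'n" assume A: "r < rank A"
    obtain Y where Y: "A ** Y ** A = A" by (rule generalized_inverse_exists)
    define e where "e = Y ** A"
    have e: "e ** e = e" unfolding e_def using Y by (metis matrix_mul_assoc)
    have "rank A \<le> rank e" by (metis e_def Y matrix_mul_assoc rank_mul_le_right_gen)
    define T where "T = {B. det (mat 1 - e + Y ** B) \<noteq> 0}"
    have "T = (\<lambda>B. det (mat 1 - e + Y ** B)) -` (- {0})" by (auto simp: T_def)
    then have "open T"
      by (simp only:) (intro open_vimage continuous_on_det continuous_intros continuous_on_matrix_mult_left; simp)
    moreover have "A \<in> T" by (simp add: T_def e_def)
    moreover have "T \<subseteq> {A. r < rank A}"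
    proof
      fix B assume "B \<in> T"
      then have "invertible (mat 1 - e + Y ** B)" by (simp add: T_def invertible_det_nz)
      then have "rank e \<le> rank (Y ** B)" by (rule rank_ge_if_idempotent_perturbation[OF e])
      also have "\<dots> \<le> rank B" by (rule rank_mul_le_right_gen)
      finally show "B \<in> {A. r < rank A}" using A \<open>rank A \<le> rank e\<close> by simp
    qed
    ultimately show "\<exists>T. open T \<and> A \<in> T \<and> T \<subseteq> {A. r < rank A}" by blast
  qed
  moreover have "- {A :: complex^'m^'n. rank A \<le> r} = {A. r < rank A}" by auto
  ultimately show ?thesis by (simp add: closed_def)
qed

section \<open>Low-rank elements of matrix subspaces\<close>

lemma norm_vec_power2: "(norm (x :: complex^'a))\<^sup>2 = (\<Sum>i\<in>UNIV. (cmod (x $ i))\<^sup>2)"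
  by (simp add: norm_vec_def L2_set_def sum_nonneg)

text \<open>The cross terms carry the factors t, \<open>t\<^sup>2\<close> and
  \<open>s\<^sup>2\<close> t up to conjugation, and each of these has mean zero over the four
  points. The two points s and -s would leave the cross term of \<open>a\<close> and
  \<open>c\<close>.\<close>

lemma four_point_mean:
  fixes a b c :: "complex^'a" and s :: real
  shows "(\<Sum>t\<leftarrow>[of_real s, - of_real s, \<i> * of_real s, - \<i> * of_real s]. (norm (a + t *s b + t\<^sup>2 *s c))\<^sup>2)
    = 4 * ((norm a)\<^sup>2 + s\<^sup>2 * (norm b)\<^sup>2 + s^4 * (norm c)\<^sup>2)"
proof -
  have "(\<Sum>t\<leftarrow>[of_real s, - of_real s, \<i> * of_real s, - \<i> * of_real s]. (cmod (x + t * y + t\<^sup>2 * z))\<^sup>2)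
    = 4 * ((cmod x)\<^sup>2 + s\<^sup>2 * (cmod y)\<^sup>2 + s^4 * (cmod z)\<^sup>2)" for x y z
    by (simp add: cmod_power2) (simp add: power2_eq_square power4_eq_xxxx algebra_simps)
  then show ?thesis
    by (simp add: norm_vec_power2 sum_distrib_left flip: sum.distrib)
qed

lemma scaleR_eq_smult: "r *\<^sub>R x = of_real r *s (x :: complex^'a)"
  by (simp add: vec_eq_iff) (simp add: scaleR_conv_of_real)

lemma closed_vec_subspace:
  fixes W :: "(complex^'a) set"
  assumes "vec.subspace W"
  shows "closed W"
proof -
  have "subspace W"
    using assms unfolding vec.subspace_def subspace_def scaleR_eq_smult by auto
  then show ?thesis by (rule closed_subspace)
qed

text \<open>Minimise the distance to \<open>W\<close> over the unit vectors of \<open>X\<close>, say at \<open>x0\<close> with nearest point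
  \<open>v0\<close>. Moving \<open>x0\<close> along the complex curve and \<open>v0\<close> along its tangent \<open>\<xi> \<in> W\<close> changes
  \<open>x0 - v0\<close> only to second order, with vanishing mean over the four parameters
  \<open>t = s, -s, i s, -i s\<close>, while the mean of the squared norm on \<open>X\<close> grows by \<open>s\<^sup>2 norm(\<xi>)\<^sup>2\<close>;
  so the minimum is 0.\<close>

lemma cone_meets_subspace:
  fixes X W :: "(complex^'a) set"
  assumes X: "closed X" and cone: "\<And>c x. c > 0 \<Longrightarrow> x \<in> X \<Longrightarrow> c *\<^sub>R x \<in> X"
    and W: "vec.subspace W" and ne: "x1 \<in> X" "x1 \<noteq> 0"
    and curve: "\<And>x. x \<in> X \<Longrightarrow> x \<noteq> 0 \<Longrightarrow>
      \<exists>\<xi> \<zeta>. \<xi> \<in> W \<and> \<xi> \<noteq> 0 \<and> (\<forall>t. x + t *s \<xi> + t\<^sup>2 *s \<zeta> \<in> X)"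
  shows "\<exists>x\<in>X \<inter> W. x \<noteq> 0"
proof -
  have clW: "closed W" by (rule closed_vec_subspace) fact
  have W0: "0 \<in> W" by (rule vec.subspace_0) fact
  define K where "K = X \<inter> sphere 0 1"
  have "compact K" unfolding K_def using X by (intro closed_Int_compact) auto
  moreover have "(1 / norm x1) *\<^sub>R x1 \<in> K" using ne cone by (simp add: K_def)
  ultimately obtain x0 where x0: "x0 \<in> K" and min: "\<And>x. x \<in> K \<Longrightarrow> infdist x0 W \<le> infdist x W"
    using continuous_attains_inf[of K "\<lambda>x. infdist x W"] by (force intro!: continuous_intros)
  obtain v0 where v0: "v0 \<in> W" and v0_min: "\<And>v. v \<in> W \<Longrightarrow> dist x0 v0 \<le> dist x0 v"
    using distance_attains_inf[OF clW, of x0] W0 by blast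
  define \<mu> where "\<mu> = dist x0 v0"
  have \<mu>_le: "\<mu> \<le> infdist x0 W"
    unfolding \<mu>_def using W0 v0_min by (subst infdist_notempty) (auto intro!: cINF_greatest)
  have n0: "norm x0 = 1" "x0 \<in> X" using x0 by (auto simp: K_def)
  \<comment> \<open>By homogeneity the minimal distance on the unit sphere becomes an inequality on
    the whole cone \<open>X\<close>.\<close>
  have key: "\<mu> * norm x \<le> norm (x - v)" if "x \<in> X" "v \<in> W" for x v
  proof (cases "x = 0")
    case False
    have "(1 / norm x) *\<^sub>R x \<in> K" using False that cone by (simp add: K_def)
    from \<mu>_le min[OF this] have "\<mu> \<le> infdist ((1 / norm x) *\<^sub>R x) W" by simp
    also have "\<dots> \<le> dist ((1 / norm x) *\<^sub>R x) ((1 / norm x) *\<^sub>R v)"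
      unfolding scaleR_eq_smult[of _ v] by (intro infdist_le vec.subspace_scale W that)
    also have "\<dots> = norm (x - v) / norm x"
      by (simp add: dist_norm flip: scaleR_diff_right)
    finally show ?thesis using False by (simp add: field_simps)
  qed simp
  obtain \<xi> \<zeta> where \<xi>: "\<xi> \<in> W" "\<xi> \<noteq> 0" and path: "\<And>t. x0 + t *s \<xi> + t\<^sup>2 *s \<zeta> \<in> X"
    using curve[of x0] n0 by fastforce
  have "\<mu> = 0"
  proof (rule ccontr)
    assume "\<mu> \<noteq> 0"
    then have \<mu>: "\<mu> > 0" by (simp add: \<mu>_def)
    \<comment> \<open>This choice makes \<open>s\<^sup>2 * (norm \<zeta>)\<^sup>2\<close> strictly
      smaller than \<open>\<mu>\<^sup>2 * (norm \<xi>)\<^sup>2\<close>, against the averaged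
      inequality; the summand 1 gives strictness and a nonzero denominator.\<close>
    define s where "s = sqrt (\<mu>\<^sup>2 * (norm \<xi>)\<^sup>2 / ((norm \<zeta>)\<^sup>2 + 1))"
    have pos: "\<mu>\<^sup>2 * (norm \<xi>)\<^sup>2 > 0" using \<mu> \<xi> by simp
    have s: "s > 0" unfolding s_def using pos by (simp add: add_nonneg_pos)
    have s2: "s\<^sup>2 * ((norm \<zeta>)\<^sup>2 + 1) = \<mu>\<^sup>2 * (norm \<xi>)\<^sup>2"
    proof -
      have "(norm \<zeta>)\<^sup>2 + 1 > 0" by (simp add: add_nonneg_pos)
      then show ?thesis unfolding s_def using pos by (subst real_sqrt_pow2) (auto simp: field_simps)
    qed
    \<comment> \<open>Comparing with the point \<open>v0 + t *s \<xi>\<close> of \<open>W\<close>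
      cancels the linear term. The summand \<open>t *s 0\<close> brings the difference into the
      shape of \<open>four_point_mean\<close>.\<close>
    have le: "\<mu>\<^sup>2 * (norm (x0 + t *s \<xi> + t\<^sup>2 *s \<zeta>))\<^sup>2 \<le> (norm ((x0 - v0) + t *s 0 + t\<^sup>2 *s \<zeta>))\<^sup>2" for t
    proof -
      have "v0 + t *s \<xi> \<in> W" by (intro vec.subspace_add vec.subspace_scale W v0 \<xi>)
      from key[OF path[of t] this] have "\<mu> * norm (x0 + t *s \<xi> + t\<^sup>2 *s \<zeta>) \<le> norm ((x0 - v0) + t *s 0 + t\<^sup>2 *s \<zeta>)"
        by (simp add: algebra_simps)
      then have "(\<mu> * norm (x0 + t *s \<xi> + t\<^sup>2 *s \<zeta>))\<^sup>2 \<le> (norm ((x0 - v0) + t *s 0 + t\<^sup>2 *s \<zeta>))\<^sup>2"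
        using \<mu> by (intro power_mono) auto
      then show ?thesis by (simp add: power_mult_distrib)
    qed
    have "\<mu>\<^sup>2 * (4 * ((norm x0)\<^sup>2 + s\<^sup>2 * (norm \<xi>)\<^sup>2 + s^4 * (norm \<zeta>)\<^sup>2))
      \<le> 4 * ((norm (x0 - v0))\<^sup>2 + s\<^sup>2 * (norm (0 :: complex^'a))\<^sup>2 + s^4 * (norm \<zeta>)\<^sup>2)"
      unfolding four_point_mean[symmetric] sum_list_const_mult[symmetric]
      by (intro sum_list_mono le)
    then have "\<mu>\<^sup>2 * (s\<^sup>2 * (norm \<xi>)\<^sup>2) + \<mu>\<^sup>2 * (s^4 * (norm \<zeta>)\<^sup>2) \<le> s^4 * (norm \<zeta>)\<^sup>2"
      by (simp add: n0 \<mu>_def dist_norm algebra_simps)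
    moreover have "0 \<le> \<mu>\<^sup>2 * (s^4 * (norm \<zeta>)\<^sup>2)" by simp
    ultimately have "\<mu>\<^sup>2 * (s\<^sup>2 * (norm \<xi>)\<^sup>2) \<le> s^4 * (norm \<zeta>)\<^sup>2" by linarith
    then have "s\<^sup>2 * (\<mu>\<^sup>2 * (norm \<xi>)\<^sup>2) \<le> s\<^sup>2 * (s\<^sup>2 * (norm \<zeta>)\<^sup>2)"
      by (simp add: algebra_simps power2_eq_square power4_eq_xxxx)
    then have "\<mu>\<^sup>2 * (norm \<xi>)\<^sup>2 \<le> s\<^sup>2 * (norm \<zeta>)\<^sup>2"
      by (rule mult_left_le_imp_le) (use s in simp)
    then show False using s2 s by (simp add: distrib_left) (smt (verit) zero_less_power)
  qed
  then have "x0 = v0" by (simp add: \<mu>_def)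
  then show ?thesis using n0 v0 by (intro bexI[of _ x0]) auto
qed

section \<open>Coefficient matrices and two-sided multiplication\<close>

definition vec_of_mat :: "complex^'m^'n \<Rightarrow> complex^('n \<times> 'm)" where
  "vec_of_mat A = (\<chi> k. A $ fst k $ snd k)"

lemma coeff_mat_vec_of_mat [simp]: "coeff_mat (vec_of_mat A) = A"
  by (simp add: coeff_mat_def vec_of_mat_def vec_eq_iff)

lemma vec_of_mat_coeff_mat [simp]: "vec_of_mat (coeff_mat v) = v"
  by (simp add: coeff_mat_def vec_of_mat_def vec_eq_iff)

lemma vec_of_mat_eq_0_iff [simp]: "vec_of_mat A = 0 \<longleftrightarrow> A = 0"
  by (auto simp: vec_of_mat_def vec_eq_iff)

lemma coeff_mat_eq_0_iff [simp]: "coeff_mat v = 0 \<longleftrightarrow> v = 0"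
  by (auto simp: coeff_mat_def vec_eq_iff)

text \<open>On a matrix, the scalar of \<open>*s\<close> would have to be a row vector, and that of
  \<open>scaleR\<close> a real number.\<close>

definition cscale :: "complex \<Rightarrow> complex^'m^'n \<Rightarrow> complex^'m^'n" where
  "cscale t A = (\<chi> i j. t * A $ i $ j)"

lemma coeff_mat_add: "coeff_mat (v + w) = coeff_mat v + coeff_mat w"
  and coeff_mat_scale: "coeff_mat (t *s v) = cscale t (coeff_mat v)"
  by (simp_all add: coeff_mat_def cscale_def vec_eq_iff)

lemma cscale_mult_left: "cscale t A ** B = cscale t (A ** B)"
  and cscale_mult_right: "A ** cscale t B = cscale t (A ** B)"
  by (simp_all add: cscale_def matrix_matrix_mult_def vec_eq_iff sum_distrib_left mult.assoc mult.left_commute)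

lemma cscale_add: "cscale t (A + B) = cscale t A + cscale t B"
  and cscale_diff: "cscale t (A - B) = cscale t A - cscale t B"
  and cscale_cscale: "cscale t (cscale u A) = cscale (t * u) A"
  by (simp_all add: cscale_def vec_eq_iff algebra_simps)

lemma rank_cscale_le: "rank (cscale t A) \<le> rank A"
  using rank_mul_le_right_gen[of "cscale t (mat 1)" A] by (simp add: cscale_mult_left)

text \<open>This is the operator p (x) q^T on the tensor product.\<close>

definition sandwich :: "complex^'n^'n \<Rightarrow> complex^'m^'m \<Rightarrow> complex^('n \<times> 'm) \<Rightarrow> complex^('n \<times> 'm)" where
  "sandwich p q v = vec_of_mat (p ** coeff_mat v ** q)"

lemma linear_sandwich: "Vector_Spaces.linear (*s) (*s) (sandwich p q)"
proof -
  have inj: "v = w" if "coeff_mat v = coeff_mat w" for v w :: "complex^('k::finite \<times> 'l::finite)"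
    using that by (metis vec_of_mat_coeff_mat)
  show ?thesis
    by (intro Vector_Spaces.linear_iff[THEN iffD2] conjI allI inj vec.vector_space_axioms)
      (simp_all add: sandwich_def coeff_mat_add coeff_mat_scale matrix_distribs cscale_mult_left cscale_mult_right)
qed

text \<open>The image of \<open>sandwich p q\<close> has dimension at most
  \<open>rank p * rank q\<close>, so the map cannot be injective on a larger space. This is the case
  r = 0 of the dimension count.\<close>

lemma sandwich_kernel:
  fixes V :: "(complex^('n::finite \<times> 'm::finite)) set"
    and p :: "complex^'n^'n" and q :: "complex^'m^'m"
  assumes V: "vec.subspace V" and dim: "rank p * rank q < vec.dim V"
  shows "\<exists>\<xi>\<in>V. \<xi> \<noteq> 0 \<and> p ** coeff_mat \<xi> ** q = 0"
proof (rule ccontr)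
  assume "\<not> ?thesis"
  then have ker: "\<xi> = 0" if "\<xi> \<in> V" "sandwich p q \<xi> = 0" for \<xi>
    using that by (auto simp: sandwich_def)
  interpret L: Vector_Spaces.linear "(*s)" "(*s)" "sandwich p q" by (rule linear_sandwich)
  have "inj_on (sandwich p q) (vec.span V)"
    using ker V by (intro L.inj_on_iff_eq_0[THEN iffD2] ballI impI) (auto simp: vec.span_eq_iff[THEN iffD2])
  from vec.dim_image_eq[OF linear_sandwich this]
  have "vec.dim V = vec.dim (sandwich p q ` V)" by simp
  also have "\<dots> \<le> rank p * rank q"
  proof -
    obtain S u where S: "finite S" "card S = rank p" and p: "\<And>i j. p $ i $ j = (\<Sum>b\<in>S. u b i * b $ j)"
      by (rule rank_factorization[of p]) blast
    obtain T w where T: "finite T" "card T = rank q" and q: "\<And>i j. q $ i $ j = (\<Sum>c\<in>T. w c i * c $ j)"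
      by (rule rank_factorization[of q]) blast
    define E where "E = (\<lambda>(b, c). (\<chi> k. u b (fst k) * c $ snd k) :: complex^('n \<times> 'm))"
    have "sandwich p q \<xi> \<in> vec.span (E ` (S \<times> T))" for \<xi>
    proof -
      define A where "A = coeff_mat \<xi>"
      \<comment> \<open>Inserting both factorizations, the outer product of \<open>u b\<close> and
        \<open>c\<close> receives the scalar b^T A w_c as coefficient; only the order of the four
        sums changes.\<close>
      have "(p ** A ** q) $ i $ j = (\<Sum>b\<in>S. \<Sum>c\<in>T. (\<Sum>l\<in>UNIV. \<Sum>k\<in>UNIV. b $ k * A $ k $ l * w c l) * (u b i * c $ j))" for i j
      proof -
        have "(p ** A ** q) $ i $ j = (\<Sum>l\<in>UNIV. \<Sum>k\<in>UNIV. \<Sum>b\<in>S. \<Sum>c\<in>T. (b $ k * A $ k $ l * w c l) * (u b i * c $ j))"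
          by (simp add: matrix_matrix_mult_def p q sum_distrib_left sum_distrib_right mult_ac)
        also have "\<dots> = (\<Sum>l\<in>UNIV. \<Sum>b\<in>S. \<Sum>k\<in>UNIV. \<Sum>c\<in>T. (b $ k * A $ k $ l * w c l) * (u b i * c $ j))"
          by (intro sum.cong refl sum.swap)
        also have "\<dots> = (\<Sum>b\<in>S. \<Sum>l\<in>UNIV. \<Sum>k\<in>UNIV. \<Sum>c\<in>T. (b $ k * A $ k $ l * w c l) * (u b i * c $ j))"
          by (rule sum.swap)
        also have "\<dots> = (\<Sum>b\<in>S. \<Sum>l\<in>UNIV. \<Sum>c\<in>T. \<Sum>k\<in>UNIV. (b $ k * A $ k $ l * w c l) * (u b i * c $ j))"
          by (intro sum.cong refl sum.swap)
        also have "\<dots> = (\<Sum>b\<in>S. \<Sum>c\<in>T. \<Sum>l\<in>UNIV. \<Sum>k\<in>UNIV. (b $ k * A $ k $ l * w c l) * (u b i * c $ j))"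
          by (intro sum.cong refl sum.swap)
        finally show ?thesis by (simp add: sum_distrib_right)
      qed
      then have "sandwich p q \<xi> = (\<Sum>b\<in>S. \<Sum>c\<in>T. (\<Sum>l\<in>UNIV. \<Sum>k\<in>UNIV. b $ k * A $ k $ l * w c l) *s E (b, c))"
        by (simp add: sandwich_def vec_of_mat_def A_def E_def vec_eq_iff)
      moreover have "E (b, c) \<in> vec.span (E ` (S \<times> T))" if "b \<in> S" "c \<in> T" for b c
        using that by (intro vec.span_base) blast
      ultimately show ?thesis
        by (simp add: vec.span_sum vec.span_scale)
    qed
    then have "vec.dim (sandwich p q ` V) \<le> card (E ` (S \<times> T))"
      using S T by (intro vec.dim_le_card) auto
    also have "\<dots> \<le> card (S \<times> T)" by (rule card_image_le) (simp add: S T)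
    finally show ?thesis using S T by (simp add: card_cartesian_product)
  qed
  finally show False using dim by simp
qed

text \<open>The curve equals \<open>(1 + t D Y) A (1 + t Y Z) + t (D - D Y A)\<close>; its velocity at 0 is \<open>Z\<close>.\<close>

lemma rank_le_curve:
  fixes A Z :: "complex^'m^'n" and Y :: "complex^'n^'m"
  assumes AYA: "A ** Y ** A = A" and YAY: "Y ** A ** Y = Y"
  defines "D \<equiv> Z - A ** Y ** Z"
  shows "rank (A + cscale t Z + cscale (t\<^sup>2) (D ** Y ** Z)) \<le> rank A + rank (D - D ** Y ** A)"
proof -
  let ?L = "mat 1 + cscale t (D ** Y)" and ?R = "mat 1 + cscale t (Y ** Z)"
  have YAY': "M ** Y ** A ** Y = M ** Y" for M :: "complex^'m^'k"
    by (metis YAY matrix_mul_assoc)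
  have "A + cscale t Z + cscale (t\<^sup>2) (D ** Y ** Z) = ?L ** A ** ?R + cscale t (D - D ** Y ** A)"
    by (simp add: matrix_distribs cscale_mult_left cscale_mult_right cscale_add cscale_diff cscale_cscale
      matrix_mul_assoc power2_eq_square YAY') (simp add: D_def cscale_diff)
  then have "rank (A + cscale t Z + cscale (t\<^sup>2) (D ** Y ** Z))
    \<le> rank (?L ** A ** ?R) + rank (cscale t (D - D ** Y ** A))"
    by (simp add: rank_add_le)
  moreover have "rank (?L ** A ** ?R) \<le> rank A"
    using rank_mul_le_left_gen rank_mul_le_right_gen order_trans by blast
  ultimately show ?thesis using rank_cscale_le[of t "D - D ** Y ** A"] by linarith
qed

text \<open>The middle \<open>Y0 ** A ** Y0\<close> gives reflexivity, and the outer factors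
  \<open>q\<close> and \<open>p\<close> confine \<open>Y\<close> to the block cut out by the
  idempotents, so that \<open>A ** Y\<close> and \<open>Y ** A\<close> are absorbed by
  \<open>p\<close> and \<open>q\<close>.\<close>

lemma reflexive_inverse_exists:
  fixes A :: "'a::field^'m^'n"
  assumes pA: "p ** A = A" and Aq: "A ** q = A" and p: "p ** p = p" and q: "q ** q = q"
  obtains Y where "A ** Y ** A = A" "Y ** A ** Y = Y" "q ** Y = Y" "Y ** p = Y"
proof -
  obtain Y0 where Y0: "A ** Y0 ** A = A" by (rule generalized_inverse_exists)
  define Y where "Y = q ** Y0 ** A ** Y0 ** p"
  have assoc: "M ** p ** A = M ** A" "M ** A ** q = M ** A" "M ** A ** Y0 ** A = M ** A"
    "M ** p ** p = M ** p" for M :: "'a^'n^'k"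
    using pA Aq Y0 p by (simp_all flip: matrix_mul_assoc)
  show ?thesis
    by (rule that[of Y]) (simp_all add: Y_def matrix_mul_assoc assoc pA Aq Y0 p q)
qed

text \<open>A projective dimension count for determinantal varieties. The idempotents \<open>p\<close>, \<open>q\<close> only serve
  the induction: at a minimiser \<open>A\<close> of rank \<open>s\<close>, the induction hypothesis for \<open>r - s\<close>, applied after
  splitting off the column and row space of \<open>A\<close>, yields a tangent direction in \<open>V\<close>.\<close>

lemma subspace_contains_low_rank:
  fixes V :: "(complex^('n::finite \<times> 'm::finite)) set"
    and p :: "complex^'n^'n" and q :: "complex^'m^'m"
  assumes V: "vec.subspace V" and "p ** p = p" "q ** q = q"
    and "(rank p - r) * (rank q - r) < vec.dim V"
  shows "\<exists>\<xi>\<in>V. \<xi> \<noteq> 0 \<and> rank (p ** coeff_mat \<xi> ** q) \<le> r"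
  using assms(2-)
proof (induction r arbitrary: p q rule: less_induct)
  case (less r)
  show ?case
  proof (cases "r = 0")
    case True
    then show ?thesis using sandwich_kernel[OF V, of p q] less.prems by (auto simp: rank_eq_0_gen)
  next
    case r: False
    show ?thesis
    proof (rule ccontr)
      assume "\<not> ?thesis"
      then have no: "r < rank (p ** coeff_mat \<xi> ** q)" if "\<xi> \<in> V" "\<xi> \<noteq> 0" for \<xi>
        using that by (meson not_le)
      \<comment> \<open>\<open>X\<close> is the cone of low-rank matrices in the block of
        \<open>p\<close> and \<open>q\<close>, and \<open>W\<close> is the compression of
        \<open>V\<close> to that block. A nonzero common point of both contradicts
        \<open>no\<close>.\<close>
      define X where "X = {x :: complex^('n \<times> 'm). rank (coeff_mat x) \<le> r \<and> p ** coeff_mat x ** q = coeff_mat x}"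
      define W where "W = sandwich p q ` V"
      have Mq: "M ** q ** q = M ** q" for M :: "complex^'m^'k" by (metis less.prems(2) matrix_mul_assoc)
      have cont: "continuous_on UNIV (coeff_mat :: complex^('n \<times> 'm) \<Rightarrow> _)"
        unfolding coeff_mat_def by (intro continuous_intros)
      have "closed X"
      proof -
        have "closed (coeff_mat -` {A. rank A \<le> r} :: (complex^('n \<times> 'm)) set)"
          using closed_rank_le cont by (rule closed_vimage)
        moreover have "closed {x :: complex^('n \<times> 'm). p ** coeff_mat x ** q = coeff_mat x}"
          by (intro closed_Collect_eq continuous_on_matrix_mult_left continuous_on_matrix_mult_right cont)
        ultimately show ?thesis
          unfolding X_def Collect_conj_eq vimage_def by (auto intro: closed_Int)
      qed
      moreover have "c *\<^sub>R x \<in> X" if "x \<in> X" for c x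
      proof -
        have "coeff_mat (c *\<^sub>R x) = cscale (of_real c) (coeff_mat x)"
          by (simp add: scaleR_eq_smult coeff_mat_scale)
        then show ?thesis
          using that rank_cscale_le[of "of_real c" "coeff_mat x"]
          by (simp add: X_def cscale_mult_left cscale_mult_right)
      qed
      moreover have "vec.subspace W"
      proof -
        interpret L: Vector_Spaces.linear "(*s)" "(*s)" "sandwich p q" by (rule linear_sandwich)
        show ?thesis unfolding W_def using V by (rule L.subspace_image)
      qed
      moreover obtain x1 where "x1 \<in> X" "x1 \<noteq> 0"
      proof -
        obtain \<xi> where "\<xi> \<in> V" "\<xi> \<noteq> 0"
          using less.prems(3) by (metis less_nat_zero_code singletonI subsetI vec.dim_eq_0)
        then have "p \<noteq> 0" "q \<noteq> 0" using no[of \<xi>] rank_eq_0_gen[of "p ** coeff_mat \<xi> ** q"] by auto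
        then have "\<exists>i k. p $ i $ k \<noteq> 0" "\<exists>l j. q $ l $ j \<noteq> 0"
          unfolding vec_eq_iff[of p] vec_eq_iff[of q] by (auto simp: vec_eq_iff)
        then obtain i k l j where nz: "p $ i $ k \<noteq> 0" "q $ l $ j \<noteq> 0" by blast
        \<comment> \<open>\<open>E\<close> is a nonzero column of \<open>p\<close> times a nonzero
          row of \<open>q\<close>, the compression of the matrix unit \<open>F\<close>. It has rank
          at most 1, hence lies in \<open>X\<close> because \<open>r\<close> is positive.\<close>
        define E :: "complex^'m^'n" where "E = (\<chi> a b. p $ a $ k * q $ l $ b)"
        define F :: "complex^'m^'n" where "F = (\<chi> a b. if a = k \<and> b = l then 1 else 0)"
        have "p ** F = (\<chi> a b. if b = l then p $ a $ k else 0)"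
          by (simp add: vec_eq_iff F_def matrix_matrix_mult_def if_distrib flip: if_if_eq_conj cong: if_cong)
        then have "p ** F ** q = (\<chi> a b. if b = l then p $ a $ k else 0) ** q" by (rule arg_cong[where f = "\<lambda>M. M ** q"])
        also have "\<dots> = E"
          by (simp add: vec_eq_iff E_def matrix_matrix_mult_def if_distrib if_distribR cong: if_cong)
        finally have E: "p ** F ** q = E" .
        have "rank E \<le> card {()}"
          by (rule rank_sum_outer_le[where u = "\<lambda>_ a. p $ a $ k" and w = "\<lambda>_. q $ l"])
            (simp_all add: E_def)
        moreover have "p ** E ** q = E"
          unfolding E[symmetric] by (simp add: matrix_mul_assoc less.prems Mq)
        moreover have "E \<noteq> 0" using nz by (auto simp: E_def vec_eq_iff)
        ultimately show ?thesis using r by (intro that[of "vec_of_mat E"]) (auto simp: X_def)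
      qed
      moreover have "\<exists>\<xi> \<zeta>. \<xi> \<in> W \<and> \<xi> \<noteq> 0 \<and> (\<forall>t. x + t *s \<xi> + t\<^sup>2 *s \<zeta> \<in> X)"
        if x: "x \<in> X" "x \<noteq> 0" for x
      proof -
        define A where "A = coeff_mat x"
        have A: "rank A \<le> r" "p ** A ** q = A" "A \<noteq> 0" using x by (auto simp: X_def A_def)
        have pA: "p ** A = A" by (metis A(2) less.prems(1) matrix_mul_assoc)
        have Aq: "A ** q = A" by (metis A(2) less.prems(2) matrix_mul_assoc)
        obtain Y where AYA: "A ** Y ** A = A" and YAY: "Y ** A ** Y = Y"
          and qY: "q ** Y = Y" and Yp: "Y ** p = Y"
          using reflexive_inverse_exists[OF pA Aq less.prems(1,2)] .
        \<comment> \<open>\<open>p - e\<close> and \<open>q - f\<close> are again idempotents, and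
          their ranks are smaller by at least \<open>rank A\<close>.\<close>
        define e where "e = A ** Y"
        define f where "f = Y ** A"
        have "A ** Y ** p = A ** Y" "Y ** A ** q = Y ** A" by (simp_all add: Yp Aq flip: matrix_mul_assoc)
        then have e: "e ** e = e" "p ** e = e" "e ** p = e" and f: "f ** f = f" "q ** f = f" "f ** q = f"
          unfolding e_def f_def by (simp_all add: matrix_mul_assoc AYA YAY pA qY)
        have re: "rank A \<le> rank e" and rf: "rank A \<le> rank f"
          using rank_mul_le_left_gen[of e A] rank_mul_le_right_gen[of A f]
          unfolding e_def f_def by (simp_all add: matrix_mul_assoc AYA)
        have "rank (p - e) + rank e \<le> rank (p - e + e)"
          by (rule rank_orthogonal_idempotents_le) (simp_all add: matrix_distribs e less.prems)
        then have rp: "rank (p - e) \<le> rank p - rank A" using re by simp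
        have "rank (q - f) + rank f \<le> rank (q - f + f)"
          by (rule rank_orthogonal_idempotents_le) (simp_all add: matrix_distribs f less.prems)
        then have rq: "rank (q - f) \<le> rank q - rank A" using rf by simp
        have "rank A > 0" using A(3) rank_eq_0_gen[of A] by simp
        then have lt: "r - rank A < r" using r by simp
        \<comment> \<open>Both the ranks and the threshold drop by \<open>rank A\<close>, so the two
          truncated differences do not grow; \<open>rank A \<le> r\<close> is what makes the shift
          exact.\<close>
        have "(rank (p - e) - (r - rank A)) * (rank (q - f) - (r - rank A)) \<le> (rank p - r) * (rank q - r)"
          using rp rq A(1) by (intro mult_le_mono) linarith+
        also have "\<dots> < vec.dim V" by (rule less.prems)
        finally obtain \<xi>0 where \<xi>0: "\<xi>0 \<in> V" "\<xi>0 \<noteq> 0"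
          and rk: "rank ((p - e) ** coeff_mat \<xi>0 ** (q - f)) \<le> r - rank A"
          using less.IH[OF lt, of "p - e" "q - f"] by (auto simp: matrix_distribs e f less.prems)
        define Z where "Z = p ** coeff_mat \<xi>0 ** q"
        define D where "D = Z - e ** Z"
        have pZ: "p ** Z = Z" and Zq: "Z ** q = Z"
          unfolding Z_def by (simp_all add: matrix_mul_assoc less.prems Mq)
        have Z0: "Z \<noteq> 0" using no[OF \<xi>0] rank_eq_0_gen[of Z] by (auto simp: Z_def)
        \<comment> \<open>The part of \<open>Z\<close> outside the column and row space of
          \<open>A\<close> is the compression bounded by the induction hypothesis. With
          \<open>rank_le_curve\<close> the curve has rank at most
          \<open>rank A + (r - rank A)\<close>, which is \<open>r\<close>.\<close>
        have "D - D ** f = (p - e) ** coeff_mat \<xi>0 ** (q - f)"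
        proof -
          have "M ** q ** f = M ** f" for M :: "complex^'m^'n"
            using f by (simp flip: matrix_mul_assoc)
          then show ?thesis
            unfolding D_def Z_def by (simp add: matrix_distribs) (simp add: matrix_mul_assoc e f)
        qed
        with rk have rk: "rank (D - D ** Y ** A) \<le> r - rank A" by (simp add: f_def matrix_mul_assoc)
        have "x + t *s vec_of_mat Z + t\<^sup>2 *s vec_of_mat (D ** Y ** Z) \<in> X" for t
        proof -
          have c: "coeff_mat (x + t *s vec_of_mat Z + t\<^sup>2 *s vec_of_mat (D ** Y ** Z))
            = A + cscale t Z + cscale (t\<^sup>2) (D ** Y ** Z)"
            by (simp add: coeff_mat_add coeff_mat_scale A_def)
          have pD: "p ** D = D" by (simp add: D_def matrix_distribs pZ matrix_mul_assoc e)
          have "p ** (A + cscale t Z + cscale (t\<^sup>2) (D ** Y ** Z)) ** q = A + cscale t Z + cscale (t\<^sup>2) (D ** Y ** Z)"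
            by (simp add: matrix_distribs cscale_mult_left cscale_mult_right matrix_mul_assoc pD pZ pA)
              (simp add: Aq Zq flip: matrix_mul_assoc)
          moreover have "rank (A + cscale t Z + cscale (t\<^sup>2) (D ** Y ** Z)) \<le> r"
            using rank_le_curve[OF AYA YAY, of t Z] rk A(1)
            unfolding D_def e_def by linarith
          ultimately show ?thesis by (simp add: X_def c)
        qed
        moreover have "vec_of_mat Z \<in> W" using \<xi>0 by (auto simp: W_def Z_def sandwich_def)
        ultimately show ?thesis using Z0 by (metis vec_of_mat_eq_0_iff)
      qed
      ultimately obtain x where x: "x \<in> X" "x \<in> W" "x \<noteq> 0"
        using cone_meets_subspace[of X W x1] by blast
      then obtain \<xi> where \<xi>: "\<xi> \<in> V" "x = sandwich p q \<xi>" by (auto simp: W_def)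
      with x have "\<xi> \<noteq> 0" by (auto simp: sandwich_def coeff_mat_eq_0_iff[THEN iffD2])
      from no[OF \<xi>(1) this] x(1) \<xi>(2) show False by (simp add: X_def sandwich_def)
    qed
  qed
qed

section \<open>Complex inner product and orthonormal families\<close>

definition cinner :: "complex^'a \<Rightarrow> complex^'a \<Rightarrow> complex" where
  "cinner u v = (\<Sum>i\<in>UNIV. cnj (u $ i) * v $ i)"

lemma cinner_diff_right: "cinner u (v - w) = cinner u v - cinner u w"
  and cinner_scale_right: "cinner u (c *s v) = c * cinner u v"
  and cinner_scale_left: "cinner (c *s u) v = cnj c * cinner u v"
  by (simp_all add: cinner_def sum_subtractf sum_distrib_left algebra_simps)

lemma cinner_sum_right: "cinner u (\<Sum>l\<in>I. v l) = (\<Sum>l\<in>I. cinner u (v l))"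
  unfolding cinner_def sum_component sum_distrib_left by (rule sum.swap)

lemma cinner_commute: "cinner v u = cnj (cinner u v)"
  by (simp add: cinner_def mult.commute)

lemma cinner_sum_left: "cinner (\<Sum>l\<in>I. v l) u = (\<Sum>l\<in>I. cinner (v l) u)"
  by (metis (no_types, lifting) cinner_commute cinner_sum_right cnj_sum sum.cong)

lemma cinner_self: "cinner u u = of_real ((norm u)\<^sup>2)"
  by (simp add: cinner_def norm_vec_power2 complex_norm_square mult.commute del: of_real_power)

lemma norm_scale_vec: "norm (c *s (u :: complex^'a)) = cmod c * norm u"
proof -
  have "(norm (c *s u))\<^sup>2 = (cmod c * norm u)\<^sup>2"
    by (simp add: norm_vec_power2 norm_mult power_mult_distrib sum_distrib_left)
  then show ?thesis by simp
qed

lemma cmod_cinner_le: "cmod (cinner u v) \<le> norm u * norm v"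
proof -
  have "cmod (cinner u v) \<le> (\<Sum>i\<in>UNIV. \<bar>cmod (u $ i)\<bar> * \<bar>cmod (v $ i)\<bar>)"
    unfolding cinner_def by (rule order_trans[OF norm_sum]) (simp add: norm_mult)
  also have "\<dots> \<le> norm u * norm v"
    unfolding norm_vec_def by (rule L2_set_mult_ineq)
  finally show ?thesis .
qed

lemma cinner_axis: "cinner (axis i 1) u = u $ i"
proof -
  have "cinner (axis i 1) u = (\<Sum>k\<in>UNIV. if k = i then u $ k else 0)"
    unfolding cinner_def by (intro sum.cong) (auto simp: axis_def)
  then show ?thesis by simp
qed

lemma bra_ket_cinner: "bra_ket w X v = cinner w (X *v v)"
  by (simp add: bra_ket_def cinner_def)

lemma cinner_selfadjoint:
  assumes "adjoint_mat P = P"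
  shows "cinner u (P *v v) = cinner (P *v u) v"
proof -
  have P: "cnj (P $ i $ j) = P $ j $ i" for i j
    using arg_cong[OF assms, of "\<lambda>M. M $ j $ i"] by (simp add: adjoint_mat_def)
  have "cinner u (P *v v) = (\<Sum>i\<in>UNIV. \<Sum>j\<in>UNIV. cnj (u $ i) * (P $ i $ j * v $ j))"
    by (simp add: cinner_def matrix_vector_mult_def sum_distrib_left)
  also have "\<dots> = (\<Sum>j\<in>UNIV. \<Sum>i\<in>UNIV. cnj (u $ i) * (P $ i $ j * v $ j))" by (rule sum.swap)
  also have "\<dots> = cinner (P *v u) v"
    by (simp add: cinner_def matrix_vector_mult_def sum_distrib_left sum_distrib_right P mult_ac)
  finally show ?thesis .
qed

section \<open>Orthonormal expansions and bases\<close>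

definition orthonormal :: "(complex^'a) set \<Rightarrow> bool" where
  "orthonormal B \<longleftrightarrow> (\<forall>b\<in>B. \<forall>c\<in>B. cinner b c = (if b = c then 1 else 0))"

lemma orthonormal_expansion:
  assumes "finite B" "orthonormal B" "x \<in> vec.span B"
  shows "x = (\<Sum>b\<in>B. cinner b x *s b)"
proof -
  obtain c where c: "x = (\<Sum>b\<in>B. c b *s b)"
    using assms(3) unfolding vec.span_finite[OF assms(1)] by auto
  have "cinner b x = c b" if "b \<in> B" for b
  proof -
    have "cinner b x = (\<Sum>a\<in>B. if a = b then c a else 0)"
      unfolding c cinner_sum_right cinner_scale_right
      using assms(2) that by (intro sum.cong) (auto simp: orthonormal_def)
    then show ?thesis using that assms(1) by simp
  qed
  then show ?thesis using c by simp
qed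

text \<open>For \<open>d = c\<close>, a truncated expansion has inner product with the full vector
  equal to its own squared norm.\<close>

lemma cinner_orthonormal_sums:
  assumes "finite B" "orthonormal B" "S \<subseteq> B"
  shows "cinner (\<Sum>b\<in>B. c b *s b) (\<Sum>b\<in>S. d b *s b) = (\<Sum>b\<in>S. cnj (c b) * d b)"
proof -
  have "cinner (\<Sum>a\<in>B. c a *s a) b = cnj (c b)" if "b \<in> B" for b
  proof -
    have "cinner (\<Sum>a\<in>B. c a *s a) b = (\<Sum>a\<in>B. if a = b then cnj (c a) else 0)"
      unfolding cinner_sum_left cinner_scale_left
      using assms(2) that by (intro sum.cong) (auto simp: orthonormal_def)
    then show ?thesis using that assms(1) by simp
  qed
  then show ?thesis
    unfolding cinner_sum_right cinner_scale_right
    using assms(3) by (intro sum.cong) (auto simp: mult.commute)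
qed

lemma norm_orthonormal_sum:
  assumes "finite S" "orthonormal S"
  shows "(norm (\<Sum>b\<in>S. c b *s b))\<^sup>2 = (\<Sum>b\<in>S. (cmod (c b))\<^sup>2)"
proof -
  have "complex_of_real ((norm (\<Sum>b\<in>S. c b *s b))\<^sup>2) = of_real (\<Sum>b\<in>S. (cmod (c b))\<^sup>2)"
    unfolding cinner_self[symmetric] cinner_orthonormal_sums[OF assms order_refl]
    by (simp add: complex_norm_square mult.commute del: of_real_power)
  then show ?thesis using of_real_eq_iff by blast
qed

lemma parseval:
  assumes "finite B" "orthonormal B" "x \<in> vec.span B"
  shows "(norm x)\<^sup>2 = (\<Sum>b\<in>B. (cmod (cinner b x))\<^sup>2)"
  using norm_orthonormal_sum[OF assms(1,2), of "\<lambda>b. cinner b x"]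
  by (simp flip: orthonormal_expansion[OF assms])

lemma orthonormal_subset: "orthonormal B \<Longrightarrow> S \<subseteq> B \<Longrightarrow> orthonormal S"
  unfolding orthonormal_def by blast

lemma gram_schmidt_exists:
  assumes "finite F" "vec.independent F"
  shows "\<exists>B. finite B \<and> card B = card F \<and> orthonormal B \<and> vec.span B = vec.span F"
  using assms
proof (induction F)
  case empty
  then show ?case by (auto simp: orthonormal_def)
next
  case (insert a F)
  then obtain B where B: "finite B" "card B = card F" "orthonormal B" "vec.span B = vec.span F"
    by (meson subset_insertI vec.independent_mono)
  have a: "a \<notin> vec.span B" using insert B by (simp add: vec.independent_insert)
  define s where "s = (\<Sum>b\<in>B. cinner b a *s b)"
  define v where "v = a - s"
  define u where "u = of_real (1 / norm v) *s v"
  have s: "s \<in> vec.span B" unfolding s_def by (intro vec.span_sum vec.span_scale vec.span_base)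
  have v0: "v \<noteq> 0" using a s by (auto simp: v_def)
  have orth: "cinner b u = 0" if "b \<in> B" for b
  proof -
    have "cinner b s = (\<Sum>c\<in>B. if c = b then cinner c a else 0)"
      unfolding s_def cinner_sum_right cinner_scale_right
      using B(3) that by (intro sum.cong) (auto simp: orthonormal_def)
    then show ?thesis using that B(1) by (simp add: u_def cinner_scale_right v_def cinner_diff_right)
  qed
  have uu: "cinner u u = 1"
    unfolding cinner_self u_def norm_scale_vec using v0 by (simp add: norm_divide)
  have notin: "u \<notin> B" using orth uu by force
  have "cinner u b = 0" if "b \<in> B" for b
    using orth[OF that] cinner_commute[of u b] by simp
  then have "orthonormal (insert u B)"
    using B(3) orth uu notin by (auto simp: orthonormal_def)
  moreover have "vec.span (insert u B) = vec.span (insert a F)"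
  proof -
    have "u \<in> vec.span (insert a B)"
      unfolding u_def v_def
      by (rule vec.span_scale, rule vec.span_diff)
        (use s vec.span_mono[of B "insert a B"] in \<open>auto intro: vec.span_base\<close>)
    moreover have "a \<in> vec.span (insert u B)"
    proof -
      have "a = of_real (norm v) *s u + s"
        using v0 by (simp add: u_def vector_smult_assoc flip: of_real_mult) (simp add: v_def)
      also have "\<dots> \<in> vec.span (insert u B)"
        by (rule vec.span_add, rule vec.span_scale)
          (use s vec.span_mono[of B "insert u B"] in \<open>auto intro: vec.span_base\<close>)
      finally show ?thesis .
    qed
    ultimately have "vec.span (insert u B) = vec.span (insert a B)"
      by (auto simp: vec.span_eq intro: vec.span_base)
    also have "\<dots> = vec.span (insert a F)"
      using B(4) by (simp add: vec.span_insert)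
    finally show ?thesis .
  qed
  ultimately show ?case using B insert notin
    by (intro exI[of _ "insert u B"]) simp
qed

lemma orthonormal_basis_exists:
  fixes S :: "(complex^'a) set"
  obtains B where "finite B" "card B = vec.dim S" "orthonormal B" "S \<subseteq> vec.span B"
    "vec.span B = vec.span S"
proof -
  obtain F where F: "F \<subseteq> S" "vec.independent F" "S \<subseteq> vec.span F" "card F = vec.dim S"
    using vec.basis_exists by blast
  obtain B where "finite B" "card B = card F" "orthonormal B" "vec.span B = vec.span F"
    using gram_schmidt_exists[OF vec.finiteI_independent[OF F(2)] F(2)] by blast
  moreover have "vec.span F = vec.span S"
    using F vec.span_mono[OF F(1)] vec.span_minimal[OF F(3) vec.subspace_span] by blast
  ultimately show ?thesis using that[of B] F by simp
qed

text \<open>Discarding a lightest element does not lower the average weight; repeat until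
  \<open>k\<close> elements remain. The inequality is multiplied out so that it also covers an empty
  \<open>B\<close>.\<close>

lemma large_partial_sum:
  fixes g :: "'b \<Rightarrow> real"
  assumes "finite B" "k \<le> card B" "\<And>b. b \<in> B \<Longrightarrow> g b \<ge> 0"
  shows "\<exists>S\<subseteq>B. card S = k \<and> real k * sum g B \<le> real (card B) * sum g S"
  using assms
proof (induction "card B - k" arbitrary: B)
  case 0
  then show ?case by (intro exI[of _ B]) auto
next
  case (Suc d)
  then have ne: "B \<noteq> {}" and lt: "k < card B" by auto
  define m where "m = (ARG_MIN g b. b \<in> B)"
  have m: "m \<in> B" "\<And>b. b \<in> B \<Longrightarrow> g m \<le> g b"
    using arg_min_if_finite[OF Suc.prems(1) ne, of g] unfolding m_def arg_min_on_def by (force simp: not_less)+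
  let ?B = "B - {m}"
  have card: "card ?B = card B - 1" using m Suc.prems by simp
  obtain S where S: "S \<subseteq> ?B" "card S = k" "real k * sum g ?B \<le> real (card ?B) * sum g S"
  proof -
    have "d = card ?B - k" "k \<le> card ?B" using Suc.hyps(2) lt card by auto
    then show ?thesis using that Suc.hyps(1)[of ?B] Suc.prems by blast
  qed
  have sumB: "sum g B = g m + sum g ?B" using m Suc.prems by (simp add: sum.remove)
  have mle: "real (card ?B) * g m \<le> sum g ?B"
    using sum_bounded_below[of ?B "g m" g] m by simp
  show ?case
  proof (cases "card ?B = 0")
    \<comment> \<open>Here the factor \<open>real (card ?B)\<close> could not be cancelled, but
      \<open>k < card B\<close> leaves only \<open>k = 0\<close>.\<close>
    case True
    then have "k = 0" using lt card by simp
    then show ?thesis by (intro exI[of _ "{}"]) auto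
  next
    case False
    have c: "real (card B) = real (card ?B) + 1" using card lt by simp
    have "real (card ?B) * (real k * sum g B) = real k * (real (card ?B) * g m) + real k * real (card ?B) * sum g ?B"
      by (simp add: sumB algebra_simps)
    also have "\<dots> \<le> real k * sum g ?B + real k * real (card ?B) * sum g ?B"
      using mle by (intro add_mono mult_left_mono) auto
    also have "\<dots> = real (card B) * (real k * sum g ?B)" by (simp add: c algebra_simps)
    also have "\<dots> \<le> real (card B) * (real (card ?B) * sum g S)"
      using S by (intro mult_left_mono) auto
    finally have "real (card ?B) * (real k * sum g B) \<le> real (card ?B) * (real (card B) * sum g S)"
      by (simp add: algebra_simps)
    then have "real k * sum g B \<le> real (card B) * sum g S"
      using False by (simp add: mult_le_cancel_left)
    then show ?thesis using S by (intro exI[of _ S]) auto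
  qed
qed

section \<open>Lower bounds for the \<open>S(k)\<close>-norm of a projection\<close>

text \<open>A real \<open>Sup\<close> dominates its set only if the set is bounded above; an
  operator norm bound for \<open>X\<close> provides this.\<close>

lemma cmod_bra_ket_le_SK_norm:
  fixes X :: "complex^('n::finite \<times> 'm::finite)^('n \<times> 'm)"
  assumes "norm v = 1" "norm w = 1" "schmidt_rank v \<le> k" "schmidt_rank w \<le> k"
  shows "cmod (bra_ket w X v) \<le> SK_norm k X"
proof -
  obtain K where K: "\<And>v. norm (X *v v) \<le> norm v * K"
    using bounded_linear.bounded[of "(*v) X"] linear_conv_bounded_linear[of "(*v) X"] by auto
  have "cmod (bra_ket w' X v') \<le> K" if "norm v' = 1" "norm w' = 1" for v' w'
    using cmod_cinner_le[of w' "X *v v'"] K[of v'] that by (simp add: bra_ket_cinner)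
  then have "bdd_above {cmod (bra_ket w X v) | v w.
      norm v = 1 \<and> norm w = 1 \<and> schmidt_rank v \<le> k \<and> schmidt_rank w \<le> k}"
    by (intro bdd_aboveI[of _ K]) auto
  then show ?thesis
    unfolding SK_norm_def using assms by (intro cSup_upper) blast+
qed

text \<open>For the unit vector u = w / norm(w), \<open>P *v x = x\<close> gives \<langle>x, P
  u\<rangle> = \<langle>x, u\<rangle> = norm(w). Cauchy-Schwarz yields norm(P u) \<ge> norm(w), and
  \<langle>u, P u\<rangle> is the square of norm(P u).\<close>

lemma SK_norm_projection_ge:
  fixes P :: "complex^('n::finite \<times> 'm::finite)^('n \<times> 'm)"
  assumes P: "adjoint_mat P = P" "P ** P = P" and x: "P *v x = x" "norm x = 1"
    and w: "w \<noteq> 0" "schmidt_rank w \<le> k" and xw: "cinner x w = of_real ((norm w)\<^sup>2)"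
  shows "(norm w)\<^sup>2 \<le> SK_norm k P"
proof -
  define u where "u = of_real (1 / norm w) *s w"
  have nu: "norm u = 1" using w by (simp add: u_def norm_scale_vec norm_divide)
  have "rank (cscale (of_real (1 / norm w)) (coeff_mat w)) \<le> rank (coeff_mat w)" by (rule rank_cscale_le)
  then have ru: "schmidt_rank u \<le> k" using w by (simp add: schmidt_rank_def u_def coeff_mat_scale)
  have "cinner x (P *v u) = cinner x u" by (simp add: cinner_selfadjoint[OF P(1)] x)
  also have "\<dots> = of_real (norm w)"
    using w by (simp add: u_def cinner_scale_right xw power2_eq_square)
  finally have "norm w \<le> norm (P *v u)"
    using cmod_cinner_le[of x "P *v u"] x by simp
  then have "(norm w)\<^sup>2 \<le> (norm (P *v u))\<^sup>2" by (intro power_mono) auto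
  also have "\<dots> = cmod (bra_ket u P u)"
  proof -
    have "bra_ket u P u = cinner u (P *v (P *v u))"
      by (simp add: bra_ket_cinner matrix_vector_mul_assoc P)
    also have "\<dots> = of_real ((norm (P *v u))\<^sup>2)"
      by (simp add: cinner_selfadjoint[OF P(1)] cinner_self)
    finally show ?thesis by (simp add: norm_power)
  qed
  also have "\<dots> \<le> SK_norm k P" by (rule cmod_bra_ket_le_SK_norm) (simp_all add: nu ru)
  finally show ?thesis .
qed

text \<open>Expanding the rows of \<open>x\<close> in \<open>B\<close> splits \<open>x\<close> into
  one rank-one piece per \<open>b\<close>, of squared norm \<open>g b\<close>; orthonormality of
  \<open>B\<close> makes the pieces orthogonal. The pieces in \<open>S\<close> form
  \<open>w\<close>. Both bounds arise by choosing \<open>B\<close> and \<open>S\<close>.\<close>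

lemma SK_norm_projection_ge_partial_sum:
  fixes P :: "complex^('n::finite \<times> 'm::finite)^('n \<times> 'm)"
  assumes P: "adjoint_mat P = P" "P ** P = P" and x: "P *v x = x" "norm x = 1"
    and B: "finite B" "orthonormal B" "\<And>i. row i (coeff_mat x) \<in> vec.span B"
    and S: "S \<subseteq> B" "card S \<le> k"
  defines "g \<equiv> \<lambda>b. \<Sum>i\<in>UNIV. (cmod (cinner b (row i (coeff_mat x))))\<^sup>2"
  assumes pos: "sum g S > 0"
  shows "sum g S \<le> SK_norm k P"
proof -
  define c where "c i b = cinner b (row i (coeff_mat x))" for i b
  define w where "w = vec_of_mat (\<chi> i. \<Sum>b\<in>S. c i b *s b)"
  have fS: "finite S" using S B finite_subset by blast
  have split: "(\<Sum>k\<in>UNIV. h k) = (\<Sum>i\<in>UNIV. \<Sum>j\<in>UNIV. h (i, j))" for h :: "'n \<times> 'm \<Rightarrow> 'c::comm_monoid_add"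
    by (simp add: sum.cartesian_product UNIV_Times_UNIV)
  have row: "(\<chi> j. x $ (i, j)) = (\<Sum>b\<in>B. c i b *s b)" for i
    using orthonormal_expansion[OF B] by (simp add: c_def row_def coeff_mat_def)
  have wrow: "(\<chi> j. w $ (i, j)) = (\<Sum>b\<in>S. c i b *s b)" for i
    by (simp add: w_def vec_of_mat_def vec_eq_iff)
  have norm_w: "(norm w)\<^sup>2 = sum g S"
  proof -
    have "(norm w)\<^sup>2 = (\<Sum>i\<in>UNIV. (norm (\<chi> j. w $ (i, j)))\<^sup>2)"
      by (simp add: norm_vec_power2 split)
    also have "\<dots> = (\<Sum>i\<in>UNIV. \<Sum>b\<in>S. (cmod (c i b))\<^sup>2)"
      unfolding wrow by (simp only: norm_orthonormal_sum[OF fS orthonormal_subset[OF B(2) S(1)]])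
    also have "\<dots> = sum g S" unfolding g_def c_def by (rule sum.swap)
    finally show ?thesis .
  qed
  have "cinner x w = (\<Sum>i\<in>UNIV. cinner (\<chi> j. x $ (i, j)) (\<chi> j. w $ (i, j)))"
    by (simp add: cinner_def split)
  also have "\<dots> = (\<Sum>i\<in>UNIV. \<Sum>b\<in>S. cnj (c i b) * c i b)"
    unfolding row wrow by (simp only: cinner_orthonormal_sums[OF B(1,2) S(1)])
  also have "\<dots> = of_real ((norm w)\<^sup>2)"
    unfolding norm_w g_def c_def
    by (subst sum.swap) (simp add: complex_norm_square mult.commute del: of_real_power)
  finally have xw: "cinner x w = of_real ((norm w)\<^sup>2)" .
  have "schmidt_rank w \<le> card S"
    unfolding schmidt_rank_def
    by (rule rank_sum_outer_le[where u = "\<lambda>b i. c i b" and w = "\<lambda>b. b"]) (simp_all add: w_def fS)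
  moreover have "w \<noteq> 0" using pos norm_w by auto
  ultimately show ?thesis
    using SK_norm_projection_ge[OF P x _ _ xw, of k] S norm_w by simp
qed

lemma norm_eq_sum_orthonormal_rows:
  fixes x :: "complex^('n::finite \<times> 'm::finite)"
  assumes B: "finite B" "orthonormal B" "\<And>i. row i (coeff_mat x) \<in> vec.span B"
  shows "(\<Sum>b\<in>B. \<Sum>i\<in>UNIV. (cmod (cinner b (row i (coeff_mat x))))\<^sup>2) = (norm x)\<^sup>2"
proof -
  have "(norm (row i (coeff_mat x)))\<^sup>2 = (\<Sum>b\<in>B. (cmod (cinner b (row i (coeff_mat x))))\<^sup>2)" for i
    by (rule parseval[OF B])
  then have "(\<Sum>i\<in>UNIV. (norm (row i (coeff_mat x)))\<^sup>2) = (\<Sum>b\<in>B. \<Sum>i\<in>UNIV. (cmod (cinner b (row i (coeff_mat x))))\<^sup>2)"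
    by (subst sum.swap) simp
  moreover have "(\<Sum>i\<in>UNIV. (norm (row i (coeff_mat x)))\<^sup>2) = (norm x)\<^sup>2"
    by (simp add: norm_vec_power2 row_def coeff_mat_def sum.cartesian_product UNIV_Times_UNIV)
  ultimately show ?thesis by simp
qed

lemma orthonormal_cart_basis: "orthonormal (cart_basis :: (complex^'a) set)"
proof -
  have "cinner (axis i 1) (axis j 1) = (if axis i 1 = (axis j 1 :: complex^'a) then 1 else 0)" for i j :: 'a
    by (simp add: cinner_axis axis_eq_axis) (simp add: axis_def)
  then show ?thesis unfolding orthonormal_def cart_basis_def by blast
qed

text \<open>The squared norms are the diagonal entries of \<open>P\<close>. Their sum, computed with
  an orthonormal basis of the range by exchanging two sums, is \<open>rank P\<close>, so some entry
  is at least the average.\<close>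

lemma projection_diagonal_ge:
  fixes P :: "complex^'a^'a"
  assumes P: "adjoint_mat P = P" "P ** P = P"
  shows "\<exists>a. real (rank P) / real CARD('a) \<le> (norm (P *v axis a 1))\<^sup>2"
proof (rule ccontr)
  assume "\<not> ?thesis"
  then have lt: "(norm (P *v axis a 1))\<^sup>2 < real (rank P) / real CARD('a)" for a by (simp add: not_le)
  obtain B where B: "finite B" "card B = rank P" "orthonormal B" "range ((*v) P) \<subseteq> vec.span B"
    "vec.span B = vec.span (range ((*v) P))"
    by (rule orthonormal_basis_exists[of "range ((*v) P)"]) (auto simp: rank_dim_range_gen)
  have "vec.span (range ((*v) P)) = range ((*v) P)"
    by (intro vec.span_eq_iff[THEN iffD2] vec.subspace_image) auto
  then have PB: "P *v b = b" if "b \<in> B" for b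
  proof -
    have "b \<in> range ((*v) P)"
      using that B(5) vec.span_base[of b B] \<open>vec.span (range ((*v) P)) = range ((*v) P)\<close> by simp
    then show ?thesis by (auto simp: matrix_vector_mul_assoc P)
  qed
  have "(norm (P *v axis a 1))\<^sup>2 = (\<Sum>b\<in>B. (cmod (b $ a))\<^sup>2)" for a
  proof -
    let ?y = "P *v axis a 1"
    have "(norm ?y)\<^sup>2 = (\<Sum>b\<in>B. (cmod (cinner b ?y))\<^sup>2)"
      using B(4) by (intro parseval B) auto
    also have "\<dots> = (\<Sum>b\<in>B. (cmod (b $ a))\<^sup>2)"
    proof (intro sum.cong refl)
      fix b assume "b \<in> B"
      then have "cinner b ?y = cinner b (axis a 1)" by (simp add: cinner_selfadjoint[OF P(1)] PB)
      also have "\<dots> = cnj (b $ a)" by (metis cinner_axis cinner_commute)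
      finally show "(cmod (cinner b ?y))\<^sup>2 = (cmod (b $ a))\<^sup>2" by simp
    qed
    finally show ?thesis .
  qed
  then have "(\<Sum>a\<in>UNIV. (norm (P *v axis a 1))\<^sup>2) = (\<Sum>b\<in>B. (norm b)\<^sup>2)"
    by (simp add: norm_vec_power2) (rule sum.swap)
  also have "\<dots> = (\<Sum>b\<in>B. 1)"
  proof (intro sum.cong refl)
    fix b assume "b \<in> B"
    then have "complex_of_real ((norm b)\<^sup>2) = of_real 1"
      using B(3) by (simp only: orthonormal_def cinner_self[symmetric]) simp
    then show "(norm b)\<^sup>2 = 1" using of_real_eq_iff by blast
  qed
  also have "\<dots> = real (rank P)" using B by simp
  finally have "(\<Sum>a\<in>UNIV. (norm (P *v axis a 1))\<^sup>2) = real (rank P)" .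
  moreover have "(\<Sum>a\<in>UNIV. (norm (P *v axis a 1))\<^sup>2) < (\<Sum>a\<in>(UNIV::'a set). real (rank P) / real CARD('a))"
    using lt by (intro sum_strict_mono) auto
  ultimately show False by simp
qed

lemma normalized_in_range:
  fixes P :: "complex^'a^'a"
  assumes "P ** P = P" "\<xi> \<in> range ((*v) P)" "\<xi> \<noteq> 0"
  defines "x \<equiv> of_real (1 / norm \<xi>) *s \<xi>"
  shows "P *v x = x" "norm x = 1"
proof -
  have "P *v \<xi> = \<xi>" using assms by (auto simp: matrix_vector_mul_assoc)
  then show "P *v x = x" by (simp add: x_def vector_scalar_commute)
  show "norm x = 1" using assms(3) by (simp add: x_def norm_scale_vec norm_divide)
qed

text \<open>Take for \<open>B\<close> an orthonormal basis of the row space: at most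
  \<open>r\<close> pieces share the total weight 1. Keep all of them if there are at most
  \<open>k\<close>, otherwise the \<open>k\<close> heaviest.\<close>

lemma SK_norm_projection_ge_min:
  fixes P :: "complex^('n::finite \<times> 'm::finite)^('n \<times> 'm)"
  assumes P: "adjoint_mat P = P" "P ** P = P" and x: "P *v x = x" "norm x = 1"
    and r: "schmidt_rank x \<le> r" and k: "1 \<le> k"
  shows "min 1 (real k / real r) \<le> SK_norm k P"
proof -
  obtain B where B: "finite B" "card B = schmidt_rank x" "orthonormal B" "rows (coeff_mat x) \<subseteq> vec.span B"
    using orthonormal_basis_exists[of "rows (coeff_mat x)"]
    by (metis row_rank_def_gen schmidt_rank_def)
  have rowB: "row i (coeff_mat x) \<in> vec.span B" for i using B(4) by (auto simp: rows_def)
  define g where "g = (\<lambda>b. \<Sum>i\<in>UNIV. (cmod (cinner b (row i (coeff_mat x))))\<^sup>2)"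
  have gB: "sum g B = 1"
    unfolding g_def using norm_eq_sum_orthonormal_rows[OF B(1,3) rowB] x by simp
  have g0: "g b \<ge> 0" for b by (simp add: g_def sum_nonneg)
  \<comment> \<open>Total weight 1 rules out an empty basis, so the quotient by \<open>r\<close> is
    not the default value of a division by zero.\<close>
  have "card B > 0" using gB B(1) by (auto simp: card_gt_0_iff)
  then have r0: "r > 0" using B(2) r by simp
  obtain S where S: "S \<subseteq> B" "card S \<le> k" "min 1 (real k / real r) \<le> sum g S"
  proof (cases "card B \<le> k")
    case True
    then show ?thesis using that[of B] gB by simp
  next
    case False
    then obtain S where S: "S \<subseteq> B" "card S = k" "real k * sum g B \<le> real (card B) * sum g S"
      using large_partial_sum[of B k g] B(1) g0 by auto
    have "real (card B) * sum g S \<le> real r * sum g S"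
      using B(2) r g0 by (intro mult_right_mono sum_nonneg) auto
    then have "real k / real r \<le> sum g S" using S gB r0 by (simp add: field_simps)
    then show ?thesis using that[of S] S by simp
  qed
  moreover have "min 1 (real k / real r) > 0" using k r0 by simp
  ultimately have "sum g S > 0" by linarith
  then have "sum g S \<le> SK_norm k P"
    using SK_norm_projection_ge_partial_sum[OF P x B(1,3) rowB S(1,2)] by (simp add: g_def)
  then show ?thesis using S(3) by linarith
qed

text \<open>If column \<open>j0\<close> has weight g, the best k-1 of the other m-1 columns carry at
  least (k-1)(1-g)/(m-1). The total is affine in g with slope (m-k)/(m-1) \<ge> 0, and inserting the
  lower bound \<alpha> for g gives the claim.\<close>

lemma SK_norm_projection_ge_affine:
  fixes P :: "complex^('n::finite \<times> 'm::finite)^('n \<times> 'm)"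
  assumes P: "adjoint_mat P = P" "P ** P = P" "P \<noteq> 0"
    and m: "2 \<le> CARD('m)" and k: "1 \<le> k" "k \<le> CARD('m)"
  shows "((real k - 1) * real CARD('m) * real CARD('n) + (real CARD('m) - real k) * real (rank P))
      / (real CARD('m) * real CARD('n) * (real CARD('m) - 1)) \<le> SK_norm k P"
proof -
  let ?M = "real CARD('m)" and ?N = "real CARD('n)"
  define \<alpha> where "\<alpha> = real (rank P) / (?N * ?M)"
  have \<alpha>: "\<alpha> > 0" using P(3) rank_eq_0_gen[of P] by (simp add: \<alpha>_def)
  obtain a where a: "\<alpha> \<le> (norm (P *v axis a 1))\<^sup>2"
    using projection_diagonal_ge[OF P(1,2)] by (auto simp: \<alpha>_def)
  obtain i0 j0 where ij: "a = (i0, j0)" by fastforce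
  define y where "y = P *v axis a 1"
  have y0: "y \<noteq> 0" using a \<alpha> by (auto simp: y_def)
  define x where "x = of_real (1 / norm y) *s y"
  have x: "P *v x = x" "norm x = 1"
    unfolding x_def using normalized_in_range[OF P(2) _ y0] by (simp_all add: y_def)
  \<comment> \<open>The entry is \<langle>\<open>axis a 1\<close>, P
    \<open>axis a 1\<close>\<rangle>. After normalising, entry \<open>a\<close> of \<open>x\<close>
    has modulus \<open>norm y\<close>, so column \<open>j0\<close> has weight at least
    \<alpha>.\<close>
  have "y $ a = of_real ((norm y)\<^sup>2)"
  proof -
    have "y $ a = cinner (axis a 1) (P *v y)"
      by (simp add: cinner_axis y_def matrix_vector_mul_assoc P)
    also have "\<dots> = cinner y y" by (simp add: cinner_selfadjoint[OF P(1)] y_def)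
    finally show ?thesis by (simp add: cinner_self)
  qed
  then have xa: "cmod (x $ a) = norm y"
    using y0 by (simp add: x_def norm_mult norm_divide norm_power power2_eq_square)
  define B where "B = (cart_basis :: (complex^'m) set)"
  have B: "finite B" "orthonormal B" "\<And>i. row i (coeff_mat x) \<in> vec.span B"
    unfolding B_def by (simp_all add: finite_cart_basis orthonormal_cart_basis)
  define g where "g = (\<lambda>b. \<Sum>i\<in>UNIV. (cmod (cinner b (row i (coeff_mat x))))\<^sup>2)"
  have gB: "sum g B = 1"
    unfolding g_def using norm_eq_sum_orthonormal_rows[OF B] x by simp
  have g0: "g b \<ge> 0" for b by (simp add: g_def sum_nonneg)
  let ?b = "axis j0 1 :: complex^'m"
  have b: "?b \<in> B" by (auto simp: B_def cart_basis_def)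
  have "(cmod (x $ a))\<^sup>2 \<le> g ?b"
    unfolding g_def cinner_axis
    by (rule order_trans[OF _ member_le_sum[of i0]]) (simp_all add: row_def coeff_mat_def ij)
  then have gb: "\<alpha> \<le> g ?b" using a xa by (simp add: y_def)
  have cB: "card (B - {?b}) = CARD('m) - 1" using b B by (simp add: B_def card_cart_basis)
  obtain S where S: "S \<subseteq> B - {?b}" "card S = k - 1"
    "real (k - 1) * sum g (B - {?b}) \<le> real (card (B - {?b})) * sum g S"
  proof -
    have "finite (B - {?b})" "k - 1 \<le> card (B - {?b})" using B(1) cB k by auto
    then show ?thesis using that large_partial_sum[of "B - {?b}" "k - 1" g] g0 by blast
  qed
  have fS: "finite S" using S(1) B(1) finite_subset by blast
  have "sum g (B - {?b}) = 1 - g ?b" using gB b B(1) by (simp add: sum.remove)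
  then have S3: "(real k - 1) * (1 - g ?b) \<le> (?M - 1) * sum g S"
    using S(3) cB k m by (simp add: of_nat_diff)
  have sumS: "sum g (insert ?b S) = g ?b + sum g S" using S(1) fS by (subst sum.insert) auto
  have "sum g (insert ?b S) > 0" using sumS gb \<alpha> sum_nonneg[of S g, OF g0] by linarith
  moreover have "insert ?b S \<subseteq> B" "card (insert ?b S) \<le> k"
    using S b k card_insert_le_m1[of k S ?b] by auto
  ultimately have "sum g (insert ?b S) \<le> SK_norm k P"
    using SK_norm_projection_ge_partial_sum[OF P(1,2) x B, of "insert ?b S" k] by (simp add: g_def)
  moreover have "((real k - 1) + (?M - real k) * \<alpha>) / (?M - 1) \<le> sum g (insert ?b S)"
  proof -
    have "(?M - real k) * \<alpha> \<le> (?M - real k) * g ?b" using gb k by (intro mult_left_mono) auto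
    then have "(real k - 1) + (?M - real k) * \<alpha> \<le> (?M - 1) * sum g (insert ?b S)"
      using S3 unfolding sumS by (simp add: algebra_simps)
    then show ?thesis using m by (simp add: field_simps)
  qed
  moreover have "((real k - 1) * ?M * ?N + (?M - real k) * real (rank P)) / (?M * ?N * (?M - 1))
    = ((real k - 1) + (?M - real k) * \<alpha>) / (?M - 1)"
  proof -
    have "?M - 1 > 0" "?M > 0" "?N > 0" using m by simp_all
    then show ?thesis unfolding \<alpha>_def by (simp add: divide_simps)
  qed
  ultimately show ?thesis by linarith
qed

text \<open>\<open>c\<close> is the ceiling of the smaller root of (N - t)(M - t) = d - 1, and on
  the interval from this root to \<open>M\<close> the product is at most d - 1.\<close>

lemma ceiling_root_bound:
  fixes N M d :: nat
  assumes "2 \<le> M" "M \<le> N" "1 \<le> d" "d \<le> N * M"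
  defines "c \<equiv> \<lceil>(real N + real M - sqrt ((real N - real M)\<^sup>2 + 4 * real d - 4)) / 2\<rceil>"
  shows "of_int c = real (nat c)" "(N - nat c) * (M - nat c) < d"
proof -
  define \<Delta> where "\<Delta> = (real N - real M)\<^sup>2 + 4 * real d - 4"
  have d: "1 \<le> real d" "real d \<le> real N * real M"
    using assms(3,4) by (simp_all flip: of_nat_mult)
  have lo: "real N - real M \<le> sqrt \<Delta>"
    by (rule real_le_rsqrt) (use d in \<open>simp add: \<Delta>_def\<close>)
  \<comment> \<open>The root is therefore positive and \<open>c\<close> at least 1, so
    \<open>nat\<close> does not truncate.\<close>
  have "sqrt \<Delta> < real N + real M"
  proof (rule real_less_lsqrt)
    show "0 \<le> real N + real M" by simp
    show "\<Delta> < (real N + real M)\<^sup>2" using d by (simp add: \<Delta>_def power2_eq_square algebra_simps)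
  qed
  then have c0: "c \<ge> 1" unfolding c_def \<Delta>_def[symmetric] by (simp add: le_ceiling_iff)
  then show c: "of_int c = real (nat c)" by simp
  \<comment> \<open>This keeps the natural subtractions exact and the left side nonnegative when the
    inequality is squared.\<close>
  have "c \<le> int M" unfolding c_def \<Delta>_def[symmetric] using lo by (simp add: ceiling_le_iff)
  then have cM: "nat c \<le> M" by simp
  have "(real N + real M - sqrt \<Delta>) / 2 \<le> real (nat c)"
    unfolding c[symmetric] by (simp add: c_def \<Delta>_def)
  then have le: "(real N - real (nat c)) + (real M - real (nat c)) \<le> sqrt \<Delta>" by (simp add: field_simps)
  have "((real N - real (nat c)) + (real M - real (nat c)))\<^sup>2 \<le> (sqrt \<Delta>)\<^sup>2"
    using le by (rule power_mono) (use cM assms(2) in simp)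
  also have "\<dots> = \<Delta>" using d(1) zero_le_power2[of "real N - real M"] unfolding \<Delta>_def
    by (intro real_sqrt_pow2) linarith
  \<comment> \<open>For a = N - c and b = M - c, subtract
    \<open>(a - b)\<^sup>2 = (N - M)\<^sup>2\<close> from the bound on
    \<open>(a + b)\<^sup>2\<close>.\<close>
  finally have "4 * ((real N - real (nat c)) * (real M - real (nat c))) \<le> 4 * real d - 4"
    by (simp add: \<Delta>_def power2_eq_square algebra_simps)
  then have "real ((N - nat c) * (M - nat c)) < real d" using cM assms by (simp add: of_nat_diff)
  then show "(N - nat c) * (M - nat c) < d" by (simp only: of_nat_less_iff)
qed

theorem theorem4p15:
  fixes P :: "complex^('n::finite \<times> 'm::finite)^('n \<times> 'm)"
    and k :: nat
  assumes "2 \<le> CARD('m)" and "CARD('m) \<le> CARD('n)"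
    and "1 \<le> k" and "k \<le> CARD('m)"
    and "P \<noteq> 0" and "adjoint_mat P = P" and "P ** P = P"
  shows "SK_norm k P \<ge> min 1 (real k / of_int \<lceil>(real CARD('n) + real CARD('m)
            - sqrt ((real CARD('n) - real CARD('m))\<^sup>2 + 4 * real (rank P) - 4)) / 2\<rceil>)
       \<and> SK_norm k P \<ge> ((real k - 1) * real CARD('m) * real CARD('n)
            + (real CARD('m) - real k) * real (rank P))
          / (real CARD('m) * real CARD('n) * (real CARD('m) - 1))"
proof
  define c where "c = \<lceil>(real CARD('n) + real CARD('m)
    - sqrt ((real CARD('n) - real CARD('m))\<^sup>2 + 4 * real (rank P) - 4)) / 2\<rceil>"
  have "1 \<le> rank P" using assms(5) rank_eq_0_gen[of P] by simp
  moreover have "rank P \<le> CARD('n) * CARD('m)"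
    using rank_mul_le_right_gen[of P "mat 1"] by (simp add: rank_mat_1)
  ultimately have c: "of_int c = real (nat c)" "(CARD('n) - nat c) * (CARD('m) - nat c) < rank P"
    unfolding c_def using ceiling_root_bound assms(1,2) by blast+
  have "vec.subspace (range ((*v) P))" by (intro vec.subspace_image) simp
  \<comment> \<open>With \<open>p\<close> and \<open>q\<close> the identity, the dimension count
    applies to the range of \<open>P\<close>, whose dimension is \<open>rank P\<close>.\<close>
  then obtain \<xi> where \<xi>: "\<xi> \<in> range ((*v) P)" "\<xi> \<noteq> 0" "rank (coeff_mat \<xi>) \<le> nat c"
    using subspace_contains_low_rank[of "range ((*v) P)" "mat 1" "mat 1" "nat c"] c(2)
    by (auto simp: rank_mat_1 rank_dim_range_gen[of P])
  define x where "x = of_real (1 / norm \<xi>) *s \<xi>"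
  have "schmidt_rank x \<le> nat c"
    using \<xi>(3) rank_cscale_le[of "of_real (1 / norm \<xi>)" "coeff_mat \<xi>"]
    by (simp add: schmidt_rank_def x_def coeff_mat_scale)
  then show "min 1 (real k / of_int c) \<le> SK_norm k P"
    using SK_norm_projection_ge_min[OF assms(6,7) normalized_in_range[OF assms(7) \<xi>(1,2)]] assms(3)
    by (simp add: x_def c)
qed (rule SK_norm_projection_ge_affine; fact)

end
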